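(* Let $(L,M)$ be a chip-firing pair of $n\times n$ matrices. Then the map $\chi$ defined on $\mathrm{sstab}(L,M)$ by $$\chi(\vec s) = c_{\max} - \mu(\lfloor \vec s\rfloor) + \{\vec s\}$$ takes values in $\mathrm{crit}(L,M)$, and $\chi:\mathrm{sstab}(L,M)\to \mathrm{crit}(L,M)$ is a bijection.
   Context: An (invertible, integral) $M$-matrix is an invertible $n\times n$ integer matrix $M$ with $M_{ii}>0$ for all $i$, $M_{ij}\le 0$ for all $i\ne j$, and all entries of $M^{-1}$ nonnegative. A chip-firing pair $(L,M)$ consists of an integral $n\times n$ $M$-matrix $M$ and an invertible $n\times n$ integer matrix $L$. For a real vector $\vec v$, $\lfloor \vec v\rfloor$ is the coordinatewise floor and $\{\vec v\}=\vec v-\lfloor\vec v\rfloor$. Let $\vec e_i$ be the $i$-th standard basis vector. Chip-firing on the pair. Let $R^+=\{\vec x\in\mathbb{R}^n_{\ge 0}: LM^{-1}\vec x\in\mathbb{Z}^n\}$ and $S^+=\{LM^{-1}\vec x:\vec x\in R^+\}$. Thus $\vec c\in S^+$ iff $\vec c\in \mathbb{Z}^n$ and $ML^{-1}\vec c\ge 0$ coordinatewise. The preimage of $\vec c\in S^+$ is $ML^{-1}\vec c\in R^+$. A configuration $\vec c\in S^+$ is ($z$-)superstable if for every nonzero $\vec z\in\mathbb{Z}^n_{\ge 0}$ one has $\vec c-L\vec z\notin S^+$. A configuration $\vec c\in S^+$ is stable if $\vec c-L\vec e_i\notin S^+$ for all $i$. It is reachable if there are $\vec d\in S^+$ with $\vec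 d-L\vec e_i\in S^+$ for all $1\le i\le n$ and a finite sequence of indices $i_1,\dots,i_k\in\{1,\dots,n\}$ such that $\vec c=\vec d-\sum_{j=1}^k L\vec e_{i_j}$ and $\vec d-\sum_{j=1}^{\ell}L\vec e_{i_j}\in S^+$ for all $\ell<k$. It is critical if it is both stable and reachable. $\mathrm{sstab}(L,M)\subset R^+$ is the set of preimages of superstable configurations (superstable preimages), and $\mathrm{crit}(L,M)\subset R^+$ is the set of preimages of critical configurations (critical preimages). Chip-firing on $M$ alone. A vector $\vec f\in\mathbb{Z}^n_{\ge 0}$ is a superstable configuration of $M$ if for every nonzero $\vec z\in\mathbb{Z}^n_{\ge0}$ there is $i$ with $f_i-(M\vec z)_i<0$; the set of these is $\mathrm{sstab}(M)$. For $\vec v\in\mathbb{Z}^n$, $\mathrm{sstab}(\vec v)$ denotes the unique element of $\mathrm{sstab}(M)$ lying in $\vec v+M\mathbb{Z}^n$ (existence and uniqueness are known). If $\vec s\in\mathrm{sstab}(L,M)$, then $\lfloor\vec s\rfloor\in\mathrm{sstab}(M)$ (known). Let $c_{\max}\in\mathbb{Z}^n$ be the vector with $i$-th entry $M_{ii}-1$. The map $\mu:\mathrm{sstab}(M)\to\mathrm{sstab}(M)$ is defined by $$\mu(\vec s)=\begin{cases}\vec s & \text{if } \{LM^{-1}(2\vec s)\}=\{LM^{-1}c_{\max}\},\\ \mathrm{sstab}(c_{\max}-\vec s) & \text{otherwise.}\end{cases}$$ *)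

theory Defs
  imports "HOL-Analysis.Analysis"
begin

definition real_vec :: "int ^ 'n \<Rightarrow> real ^ 'n" where
  "real_vec v = (\<chi> i. real_of_int (v $ i))"

(* Integer matrices are embedded into real matrices before speaking of
   invertibility: the constant invertible at type int would mean unimodular. *)
abbreviation real_mat :: "int ^ 'n ^ 'n \<Rightarrow> real ^ 'n ^ 'n" where
  "real_mat A \<equiv> map_matrix real_of_int A"

definition floor_vec :: "real ^ 'n \<Rightarrow> int ^ 'n" where
  "floor_vec v = (\<chi> i. \<lfloor>v $ i\<rfloor>)"

definition frac_vec :: "real ^ 'n \<Rightarrow> real ^ 'n" where
  "frac_vec v = v - real_vec (floor_vec v)"

definition integral_vec :: "real ^ 'n \<Rightarrow> bool" where
  "integral_vec v \<longleftrightarrow> (\<forall>i. v $ i \<in> \<int>)"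

definition M_matrix :: "int ^ 'n ^ 'n \<Rightarrow> bool" where
  "M_matrix M \<longleftrightarrow>
     invertible (real_mat M) \<and>
     (\<forall>i. M $ i $ i > 0) \<and>
     (\<forall>i j. i \<noteq> j \<longrightarrow> M $ i $ j \<le> 0) \<and>
     (\<forall>i j. matrix_inv (real_mat M) $ i $ j \<ge> 0)"

definition chip_firing_pair :: "int ^ 'n ^ 'n \<Rightarrow> int ^ 'n ^ 'n \<Rightarrow> bool" where
  "chip_firing_pair L M \<longleftrightarrow> M_matrix M \<and> invertible (real_mat L)"

definition LMinv :: "int ^ 'n ^ 'n \<Rightarrow> int ^ 'n ^ 'n \<Rightarrow> real ^ 'n ^ 'n" where
  "LMinv L M = real_mat L ** matrix_inv (real_mat M)"

definition MLinv :: "int ^ 'n ^ 'n \<Rightarrow> int ^ 'n ^ 'n \<Rightarrow> real ^ 'n ^ 'n" where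
  "MLinv L M = real_mat M ** matrix_inv (real_mat L)"

(* The order on vectors is the library's componentwise order. *)
definition R_plus :: "int ^ 'n ^ 'n \<Rightarrow> int ^ 'n ^ 'n \<Rightarrow> (real ^ 'n) set" where
  "R_plus L M = {x. 0 \<le> x \<and> integral_vec (LMinv L M *v x)}"

definition S_plus :: "int ^ 'n ^ 'n \<Rightarrow> int ^ 'n ^ 'n \<Rightarrow> (real ^ 'n) set" where
  "S_plus L M = {LMinv L M *v x | x. x \<in> R_plus L M}"

definition superstable :: "int ^ 'n ^ 'n \<Rightarrow> int ^ 'n ^ 'n \<Rightarrow> real ^ 'n \<Rightarrow> bool" where
  "superstable L M c \<longleftrightarrow> c \<in> S_plus L M \<and>
     (\<forall>z :: int ^ 'n. 0 \<le> z \<and> z \<noteq> 0 \<longrightarrow> c - real_mat L *v real_vec z \<notin> S_plus L M)"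

definition stable :: "int ^ 'n ^ 'n \<Rightarrow> int ^ 'n ^ 'n \<Rightarrow> real ^ 'n \<Rightarrow> bool" where
  "stable L M c \<longleftrightarrow> c \<in> S_plus L M \<and> (\<forall>i. c - real_mat L *v axis i 1 \<notin> S_plus L M)"

definition fire_seq :: "int ^ 'n ^ 'n \<Rightarrow> real ^ 'n \<Rightarrow> 'n list \<Rightarrow> real ^ 'n" where
  "fire_seq L d is = d - (\<Sum>i\<leftarrow>is. real_mat L *v axis i 1)"

definition reachable :: "int ^ 'n ^ 'n \<Rightarrow> int ^ 'n ^ 'n \<Rightarrow> real ^ 'n \<Rightarrow> bool" where
  "reachable L M c \<longleftrightarrow> c \<in> S_plus L M \<and>
     (\<exists>d \<in> S_plus L M. (\<forall>i. d - real_mat L *v axis i 1 \<in> S_plus L M) \<and>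
        (\<exists>is. c = fire_seq L d is \<and>
              (\<forall>l < length is. fire_seq L d (take l is) \<in> S_plus L M)))"

definition critical :: "int ^ 'n ^ 'n \<Rightarrow> int ^ 'n ^ 'n \<Rightarrow> real ^ 'n \<Rightarrow> bool" where
  "critical L M c \<longleftrightarrow> stable L M c \<and> reachable L M c"

definition sstab_pre :: "int ^ 'n ^ 'n \<Rightarrow> int ^ 'n ^ 'n \<Rightarrow> (real ^ 'n) set" where
  "sstab_pre L M = {MLinv L M *v c | c. superstable L M c}"

definition crit_pre :: "int ^ 'n ^ 'n \<Rightarrow> int ^ 'n ^ 'n \<Rightarrow> (real ^ 'n) set" where
  "crit_pre L M = {MLinv L M *v c | c. critical L M c}"

definition sstab :: "int ^ 'n ^ 'n \<Rightarrow> (int ^ 'n) set" where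
  "sstab M = {f. 0 \<le> f \<and> (\<forall>z. 0 \<le> z \<and> z \<noteq> 0 \<longrightarrow> (\<exists>i. f $ i - (M *v z) $ i < 0))}"

definition sstab_rep :: "int ^ 'n ^ 'n \<Rightarrow> int ^ 'n \<Rightarrow> int ^ 'n" where
  "sstab_rep M v = (THE u. u \<in> sstab M \<and> (\<exists>z. u = v + M *v z))"

definition c_max :: "int ^ 'n ^ 'n \<Rightarrow> int ^ 'n" where
  "c_max M = (\<chi> i. M $ i $ i - 1)"

definition mu :: "int ^ 'n ^ 'n \<Rightarrow> int ^ 'n ^ 'n \<Rightarrow> int ^ 'n \<Rightarrow> int ^ 'n" where
  "mu L M s =
     (if frac_vec (LMinv L M *v (2 *\<^sub>R real_vec s)) = frac_vec (LMinv L M *v real_vec (c_max M))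
      then s
      else sstab_rep M (c_max M - s))"

definition chi_map :: "int ^ 'n ^ 'n \<Rightarrow> int ^ 'n ^ 'n \<Rightarrow> real ^ 'n \<Rightarrow> real ^ 'n" where
  "chi_map L M s = real_vec (c_max M) - real_vec (mu L M (floor_vec s)) + frac_vec s"

end

theory Submission
  imports Defs
begin

text \<open>Firing subtracts the integer vector \<open>M z\<close> from a preimage \<open>s\<close>. So \<open>frac_vec s\<close> is invariant, and
  whether \<open>s\<close> is superstable or critical depends, given \<open>s \<in> R_plus\<close>, only on \<open>floor_vec s\<close>, as a
  configuration of \<open>M\<close> alone (\<open>sstab_pre_iff\<close>, \<open>crit_pre_iff\<close>). For \<open>M\<close> there is the classical
  duality: \<open>f\<close> is superstable iff \<open>c_max - f\<close> is critical (\<open>sstab_iff_recurrent\<close>). The naive map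
  that keeps the fractional part and replaces the integer part \<open>f\<close> by \<open>c_max - f\<close> may leave
  \<open>R_plus\<close>, because \<open>LMinv (c_max - 2 f)\<close> need not be integral.

  The map \<open>mu\<close> repairs this. It satisfies \<open>mu f + f \<equiv> c_max\<close> modulo the lattice of vectors that
  \<open>LMinv\<close> maps to integral vectors (\<open>mu_add_self\<close>), so \<open>c_max - mu f\<close> and \<open>f\<close> are congruent and can
  carry the same fractional part. Since each class modulo the image of \<open>M\<close> contains a unique
  superstable element (\<open>sstab_exists\<close>, \<open>sstab_unique\<close>), \<open>mu\<close> is well defined and is an involution
  of \<open>sstab M\<close> (\<open>mu_involution\<close>). Thus \<open>chi_map\<close> is inverted by the map which sends a critical
  preimage with integer part \<open>g\<close> to the one with integer part \<open>mu (c_max - g)\<close> and the same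
  fractional part.\<close>

section \<open>M-matrices acting on integer vectors\<close>

lemma real_vec_nth [simp]: "real_vec v $ i = real_of_int (v $ i)"
  by (simp add: real_vec_def)

lemma real_vec_add: "real_vec (u + v) = real_vec u + real_vec v"
  by (simp add: vec_eq_iff)

lemma real_vec_diff: "real_vec (u - v) = real_vec u - real_vec v"
  by (simp add: vec_eq_iff)

lemma real_vec_mult: "real_vec (A *v z) = real_mat A *v real_vec z"
  by (simp add: vec_eq_iff matrix_vector_mult_def)

lemma real_vec_axis: "real_vec (axis i 1) = axis i 1"
  by (simp add: vec_eq_iff axis_def)

lemma matrix_vector_mult_axis_nth: "(A *v axis j 1) $ i = A $ i $ j" for A :: "'a::semiring_1 ^ 'n ^ 'n"
  by (simp add: matrix_vector_mult_def axis_def if_distrib cong: if_cong)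

lemma invertible_matrix_inv:
  assumes "invertible (A :: real ^ 'n ^ 'n)"
  shows "A ** matrix_inv A = mat 1" and "matrix_inv A ** A = mat 1"
  using someI_ex[OF assms[unfolded invertible_def]] unfolding matrix_inv_def by auto

lemma M_matrix_inv_mult:
  assumes "M_matrix M"
  shows "matrix_inv (real_mat M) *v real_vec (M *v z) = real_vec z"
  using assms
  by (simp add: real_vec_mult matrix_vector_mul_assoc invertible_matrix_inv M_matrix_def)

lemma matrix_vector_mult_nonneg:
  fixes A :: "real ^ 'n ^ 'n"
  assumes "\<And>i j. 0 \<le> A $ i $ j" and "0 \<le> x"
  shows "0 \<le> A *v x"
  using assms by (auto simp: less_eq_vec_def matrix_vector_mult_def intro!: sum_nonneg)

lemma M_matrix_monotone:
  assumes "M_matrix M" and "0 \<le> M *v z"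
  shows "0 \<le> z"
proof -
  have "0 \<le> matrix_inv (real_mat M) *v real_vec (M *v z)"
    using assms by (intro matrix_vector_mult_nonneg) (auto simp: M_matrix_def less_eq_vec_def)
  then show ?thesis
    by (simp add: M_matrix_inv_mult[OF assms(1)] less_eq_vec_def)
qed

text \<open>Off the support of a nonnegative vector only the nonpositive off-diagonal entries
  of \<open>M\<close> contribute: firing other sites never takes chips away from a site.\<close>

lemma M_matrix_off_support:
  assumes "M_matrix M" and "0 \<le> z" and "z $ i = 0"
  shows "(M *v z) $ i \<le> 0"
proof -
  have "M $ i $ j * z $ j \<le> 0" for j
    using assms by (cases "j = i") (auto simp: M_matrix_def less_eq_vec_def mult_nonpos_nonneg)
  then show ?thesis
    by (simp add: matrix_vector_mult_def sum_nonpos)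
qed

text \<open>Rounding \<open>B *\<^sub>R M\<^sup>-\<^sup>1 1\<close> up to an integer vector changes its image under \<open>M\<close> by at most
  the absolute row sums of \<open>M\<close>, so a sufficiently large \<open>B\<close> compensates for the rounding.\<close>

lemma M_matrix_dominates:
  fixes M :: "int ^ 'n ^ 'n"
  assumes "M_matrix M"
  obtains z where "0 \<le> z" and "b \<le> M *v z"
proof -
  define C where "C i = (\<Sum>j\<in>UNIV. \<bar>real_of_int (M $ i $ j)\<bar>)" for i
  define B where "B = (\<Sum>i\<in>UNIV. \<bar>real_of_int (b $ i)\<bar> + C i)"
  define x where "x = matrix_inv (real_mat M) *v (\<chi> i. B)"
  define z :: "int ^ 'n" where "z = (\<chi> i. \<lceil>x $ i\<rceil>)"
  have C_nonneg: "0 \<le> C i" for i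
    by (auto simp: C_def intro: sum_nonneg)
  have "0 \<le> B"
    unfolding B_def by (intro sum_nonneg add_nonneg_nonneg) (auto simp: C_nonneg)
  then have "0 \<le> x"
    unfolding x_def using assms
    by (intro matrix_vector_mult_nonneg) (auto simp: M_matrix_def less_eq_vec_def)
  have "0 \<le> z $ i" for i
  proof -
    have "0 \<le> x $ i"
      using \<open>0 \<le> x\<close> by (simp add: less_eq_vec_def)
    then have "- 1 < x $ i" by linarith
    then show ?thesis by (simp add: z_def)
  qed
  then have "0 \<le> z"
    by (simp add: less_eq_vec_def)
  moreover have "b $ i \<le> (M *v z) $ i" for i
  proof -
    have "real_mat M *v x = (\<chi> i. B)"
      using assms unfolding x_def
      by (simp add: matrix_vector_mul_assoc invertible_matrix_inv M_matrix_def)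
    then have "real_of_int ((M *v z) $ i) = B + (real_mat M *v (real_vec z - x)) $ i"
      by (simp add: algebra_simps flip: real_vec_mult real_vec_nth)
    moreover have "- C i \<le> (real_mat M *v (real_vec z - x)) $ i"
    proof -
      have "\<bar>(real_mat M *v (real_vec z - x)) $ i\<bar> \<le> C i"
        unfolding C_def matrix_vector_mult_def vec_lambda_beta
      proof (rule order_trans[OF sum_abs], rule sum_mono)
        fix j
        have "\<bar>(real_vec z - x) $ j\<bar> \<le> 1"
          unfolding z_def by (simp add: real_vec_def) linarith
        then show "\<bar>real_mat M $ i $ j * (real_vec z - x) $ j\<bar> \<le> \<bar>real_of_int (M $ i $ j)\<bar>"
          by (simp add: abs_mult mult_left_le)
      qed
      then show ?thesis by linarith
    qed
    moreover have "\<bar>real_of_int (b $ i)\<bar> + C i \<le> B"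
      unfolding B_def by (rule member_le_sum) (auto simp: C_nonneg add_nonneg_nonneg)
    ultimately have "real_of_int (b $ i) \<le> real_of_int ((M *v z) $ i)"
      by linarith
    then show ?thesis by simp
  qed
  ultimately show ?thesis
    using that by (simp add: less_eq_vec_def)
qed

section \<open>One superstable representative in each class\<close>

text \<open>The sum of the entries of \<open>M\<^sup>-\<^sup>1 u\<close> is a potential: it is nonnegative for \<open>u \<ge> 0\<close>, and
  firing a nonzero \<open>z \<ge> 0\<close> lowers it by the sum of the entries of \<open>z\<close>, hence by at least 1.
  So superstabilization terminates.\<close>

lemma superstabilization:
  assumes M: "M_matrix M" and "0 \<le> u"
  shows "\<exists>z. u + M *v z \<in> sstab M"
proof -
  define \<phi> where "\<phi> u = (\<Sum>i\<in>UNIV. (matrix_inv (real_mat M) *v real_vec u) $ i)" for u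
  have nonneg: "0 \<le> \<phi> u" if "0 \<le> u" for u
  proof -
    have "0 \<le> matrix_inv (real_mat M) *v real_vec u"
      using M that by (intro matrix_vector_mult_nonneg) (auto simp: M_matrix_def less_eq_vec_def)
    then show ?thesis
      by (auto simp: \<phi>_def less_eq_vec_def intro: sum_nonneg)
  qed
  show ?thesis
    using \<open>0 \<le> u\<close>
  proof (induction "nat \<lfloor>\<phi> u\<rfloor>" arbitrary: u rule: less_induct)
    case less
    show ?case
    proof (cases "u \<in> sstab M")
      case True
      then have "u + M *v 0 \<in> sstab M" by simp
      then show ?thesis by blast
    next
      case False
      then obtain z where z: "0 \<le> z" "z \<noteq> 0" and nn: "0 \<le> u - M *v z"
        using less.prems by (force simp: sstab_def less_eq_vec_def not_less)
      obtain i where "1 \<le> z $ i"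
        using z by (auto simp: vec_eq_iff less_eq_vec_def) (metis less_le int_one_le_iff_zero_less)
      then have "1 \<le> (\<Sum>i\<in>UNIV. real_of_int (z $ i))"
        using member_le_sum[of i UNIV "\<lambda>i. real_of_int (z $ i)"] z(1)
        by (simp add: less_eq_vec_def)
      moreover have "\<phi> (u - M *v z) = \<phi> u - (\<Sum>i\<in>UNIV. real_of_int (z $ i))"
        by (simp add: \<phi>_def real_vec_diff matrix_vector_mult_diff_distrib M_matrix_inv_mult[OF M]
            sum_subtractf)
      ultimately have "nat \<lfloor>\<phi> (u - M *v z)\<rfloor> < nat \<lfloor>\<phi> u\<rfloor>"
        using nonneg[OF nn] by linarith
      from less.hyps[OF this nn] obtain z' where "u - M *v z + M *v z' \<in> sstab M" ..
      then have "u + M *v (z' - z) \<in> sstab M"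
        by (simp add: algebra_simps)
      then show ?thesis ..
    qed
  qed
qed

lemma sstab_exists:
  assumes M: "M_matrix M"
  shows "\<exists>u \<in> sstab M. \<exists>z. u = v + M *v z"
proof -
  obtain z where z: "- v \<le> M *v z"
    using M_matrix_dominates[OF M] by metis
  have "0 \<le> v $ i + (M *v z) $ i" for i
  proof -
    have "- (v $ i) \<le> (M *v z) $ i"
      using z by (simp add: less_eq_vec_def)
    then show ?thesis by simp
  qed
  then have "0 \<le> v + M *v z"
    by (simp add: less_eq_vec_def)
  from superstabilization[OF M this] obtain z' where "v + M *v z + M *v z' \<in> sstab M" ..
  then have "v + M *v (z + z') \<in> sstab M"
    by (simp add: algebra_simps)
  then show ?thesis by blast
qed

text \<open>Split \<open>z = p - q\<close> into its positive and negative part. The vector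
  \<open>u' - M p = u - M q\<close> is nonnegative, because \<open>p\<close> and \<open>q\<close> have disjoint supports and each
  expression is visibly nonnegative off one of the two supports. As \<open>u'\<close> and \<open>u\<close> are
  superstable, \<open>p = q = 0\<close>.\<close>

lemma sstab_unique:
  assumes M: "M_matrix M" and u: "u \<in> sstab M" and u': "u' \<in> sstab M" and eq: "u' = u + M *v z"
  shows "u' = u"
proof -
  define p where "p = (\<chi> i. max (z $ i) 0)"
  define q where "q = (\<chi> i. max (- z $ i) 0)"
  have z: "z = p - q"
    by (auto simp: p_def q_def vec_eq_iff)
  have nonneg: "0 \<le> p" "0 \<le> q"
    by (auto simp: p_def q_def less_eq_vec_def)
  have same: "u' - M *v p = u - M *v q"
    unfolding eq z by (simp add: algebra_simps)
  have entry: "0 \<le> u $ i" "0 \<le> u' $ i" for i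
    using u u' by (simp_all add: sstab_def less_eq_vec_def)
  have "0 \<le> (u - M *v q) $ i" for i
  proof (cases "p $ i = 0")
    case True
    then have "0 \<le> (u' - M *v p) $ i"
      using M_matrix_off_support[OF M nonneg(1) True] entry(2)[of i] by simp
    then show ?thesis unfolding same .
  next
    case False
    then have "q $ i = 0"
      by (auto simp: p_def q_def)
    then show ?thesis
      using M_matrix_off_support[OF M nonneg(2)] entry(1)[of i] by force
  qed
  then have "p = 0" "q = 0"
    using u u' nonneg same[symmetric] unfolding sstab_def
    by (auto simp flip: vector_minus_component) (metis not_less)+
  then show ?thesis
    using eq z by simp
qed

lemma sstab_rep_properties:
  assumes "M_matrix M"
  shows "sstab_rep M v \<in> sstab M" and "\<exists>z. sstab_rep M v = v + M *v z"
proof -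
  have "\<exists>!u. u \<in> sstab M \<and> (\<exists>z. u = v + M *v z)"
  proof (rule ex_ex1I)
    show "\<exists>u. u \<in> sstab M \<and> (\<exists>z. u = v + M *v z)"
      using sstab_exists[OF assms] by blast
  next
    fix u u'
    assume u: "u \<in> sstab M \<and> (\<exists>z. u = v + M *v z)" and u': "u' \<in> sstab M \<and> (\<exists>z. u' = v + M *v z)"
    then obtain z z' where "u = v + M *v z" "u' = v + M *v z'" by blast
    then have "u = u' + M *v (z - z')" by (simp add: algebra_simps)
    then show "u = u'" using sstab_unique[OF assms] u u' by blast
  qed
  from theI'[OF this] show "sstab_rep M v \<in> sstab M" "\<exists>z. sstab_rep M v = v + M *v z"
    unfolding sstab_rep_def by blast+
qed

lemma sstab_rep_eqI:
  assumes "M_matrix M" and "u \<in> sstab M" and "u = v + M *v z"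
  shows "sstab_rep M v = u"
proof -
  obtain z' where "sstab_rep M v = v + M *v z'"
    using sstab_rep_properties(2)[OF assms(1)] by blast
  then have "sstab_rep M v = u + M *v (z' - z)"
    using assms(3) by (simp add: algebra_simps)
  then show ?thesis
    using sstab_unique[OF assms(1,2) sstab_rep_properties(1)[OF assms(1)]] by blast
qed

section \<open>Duality between superstable and recurrent configurations\<close>

lemma can_fire_iff:
  assumes "M_matrix M" and "0 \<le> h"
  shows "0 \<le> h - M *v axis i 1 \<longleftrightarrow> M $ i $ i \<le> h $ i"
proof -
  have "M $ k $ i \<le> h $ k" if "k \<noteq> i" for k
  proof -
    have "M $ k $ i \<le> 0" "0 \<le> h $ k"
      using assms that by (simp_all add: M_matrix_def less_eq_vec_def)
    then show ?thesis by simp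
  qed
  then have "(\<forall>k. M $ k $ i \<le> h $ k) \<longleftrightarrow> M $ i $ i \<le> h $ i"
    by metis
  then show ?thesis
    by (simp add: less_eq_vec_def matrix_vector_mult_axis_nth)
qed

text \<open>Reachability for \<open>M\<close> alone. Closing the ample configurations, those at which every site
  can fire, under legal firings makes rule induction available for the invariant below.\<close>

inductive recurrent :: "int ^ 'n ^ 'n \<Rightarrow> int ^ 'n \<Rightarrow> bool" for M where
  ample: "(\<And>i. M $ i $ i \<le> d $ i) \<Longrightarrow> recurrent M d"
| fire: "recurrent M h \<Longrightarrow> 0 \<le> h - M *v axis i 1 \<Longrightarrow> recurrent M (h - M *v axis i 1)"

lemma recurrent_nonneg:
  assumes "M_matrix M" and "recurrent M h"
  shows "0 \<le> h"
  using assms(2)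
proof cases
  case ample
  have "0 \<le> h $ i" for i
    using assms(1) ample[of i] unfolding M_matrix_def by (meson less_le_trans less_imp_le)
  then show ?thesis by (simp add: less_eq_vec_def)
qed auto

text \<open>This invariant obstructs recurrence: for \<open>f = c_max - h\<close> and \<open>z \<ge> 0\<close> it says that
  \<open>f - M z \<ge> 0\<close> only for \<open>z = 0\<close>. It ranges over \<open>z\<close> of arbitrary sign because a firing of
  \<open>j\<close> replaces \<open>z\<close> by \<open>z - e\<^sub>j\<close>. It holds at an ample \<open>d\<close> because there \<open>M z \<le> c_max - d\<close>,
  all of whose entries are negative, and \<open>M\<close> is monotone. A legal firing of \<open>j\<close> preserves it:
  from \<open>h\<close> one gets \<open>z - e\<^sub>j \<le> 0\<close>, and \<open>z\<^sub>j = 1\<close> would force \<open>h\<^sub>j < M\<^sub>j\<^sub>j\<close>, so that \<open>j\<close>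
  could not fire.\<close>

lemma recurrent_invariant:
  assumes M: "M_matrix M" and "recurrent M h" and "h + M *v z \<le> c_max M"
  shows "z \<le> 0"
  using assms(2,3)
proof (induction arbitrary: z rule: recurrent.induct)
  case (ample d)
  have neg: "M *v (- z) = - (M *v z)"
    using matrix_vector_mult_diff_distrib[of M 0 z] by simp
  have "0 \<le> (M *v (- z)) $ i" for i
  proof -
    have "d $ i + (M *v z) $ i \<le> M $ i $ i - 1"
      using ample(2) by (auto simp: less_eq_vec_def c_max_def)
    with ample(1)[of i] show ?thesis
      by (simp add: neg)
  qed
  then have "0 \<le> - z"
    using M_matrix_monotone[OF M, of "- z"] by (simp add: less_eq_vec_def)
  then show ?case by (simp add: less_eq_vec_def)
next
  case (fire h j)
  have bound: "h + M *v (z - axis j 1) \<le> c_max M"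
    using fire.prems by (simp add: algebra_simps)
  from fire.IH[OF this] have le: "z $ i \<le> axis j 1 $ i" for i
    by (simp add: less_eq_vec_def)
  have "z $ j \<le> 0"
  proof (rule ccontr)
    assume "\<not> z $ j \<le> 0"
    with le[of j] have "z $ j = 1" by simp
    then have "(M *v (axis j 1 - z)) $ j \<le> 0"
      using le by (intro M_matrix_off_support[OF M]) (auto simp: less_eq_vec_def)
    moreover have "M $ j $ j \<le> h $ j"
      using fire.hyps(2) can_fire_iff[OF M recurrent_nonneg[OF M fire.hyps(1)]] by simp
    moreover have "h $ j + (M *v (z - axis j 1)) $ j \<le> M $ j $ j - 1"
      using bound by (auto simp: less_eq_vec_def c_max_def)
    ultimately show False
      by (simp add: matrix_vector_mult_diff_distrib)
  qed
  then have "z $ i \<le> 0" for i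
    using le[of i] by (cases "i = j") (auto simp: axis_def)
  then show ?case by (simp add: less_eq_vec_def)
qed

text \<open>If \<open>f\<close> is superstable and \<open>z \<ge> 0\<close> is nonzero, some entry of \<open>f - M z\<close> is negative. At this
  site \<open>c_max - f + M z\<close> carries at least \<open>M\<^sub>i\<^sub>i\<close> chips and \<open>z\<^sub>i > 0\<close>, so \<open>i\<close> can fire and the
  entry \<open>z\<^sub>i\<close> decreases. Hence \<open>z\<close> can be fired entirely, one site at a time.\<close>

lemma recurrent_fire_down:
  assumes M: "M_matrix M" and f: "f \<in> sstab M" and "0 \<le> z"
    and "recurrent M (c_max M - f + M *v z)"
  shows "recurrent M (c_max M - f)"
  using assms(3,4)
proof (induction "nat (\<Sum>i\<in>UNIV. z $ i)" arbitrary: z rule: less_induct)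
  case less
  let ?h = "c_max M - f + M *v z"
  show ?case
  proof (cases "z = 0")
    case True
    then show ?thesis using less.prems by simp
  next
    case False
    with less.prems f obtain i where i: "f $ i - (M *v z) $ i < 0"
      by (auto simp: sstab_def)
    then have "0 < (M *v z) $ i"
      using f by (simp add: sstab_def less_eq_vec_def) (metis le_less_trans)
    then have zi: "1 \<le> z $ i"
      using M_matrix_off_support[OF M less.prems(1), of i] less.prems(1)
      by (auto simp: less_eq_vec_def) (metis int_one_le_iff_zero_less less_le not_less)
    define z' where "z' = z - axis i 1"
    have z': "0 \<le> z'"
      using zi less.prems(1) by (auto simp: z'_def less_eq_vec_def axis_def)
    have h': "?h - M *v axis i 1 = c_max M - f + M *v z'"
      by (simp add: z'_def algebra_simps)
    have "M $ i $ i \<le> ?h $ i"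
      using i by (simp add: c_max_def)
    then have "0 \<le> ?h - M *v axis i 1"
      using can_fire_iff[OF M recurrent_nonneg[OF M less.prems(2)]] by simp
    then have "recurrent M (?h - M *v axis i 1)"
      by (rule recurrent.fire[OF less.prems(2)])
    then have "recurrent M (c_max M - f + M *v z')"
      unfolding h' .
    moreover have "nat (\<Sum>i\<in>UNIV. z' $ i) < nat (\<Sum>i\<in>UNIV. z $ i)"
    proof -
      have "(\<Sum>k\<in>UNIV. z' $ k) = (\<Sum>k\<in>UNIV. z $ k) - 1"
        by (simp add: z'_def sum_subtractf axis_def)
      moreover have "z $ i \<le> (\<Sum>k\<in>UNIV. z $ k)"
        using less.prems(1) by (intro member_le_sum) (auto simp: less_eq_vec_def)
      ultimately show ?thesis using zi by simp
    qed
    ultimately show ?thesis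
      using less.hyps z' by blast
  qed
qed

text \<open>Firing a single site \<open>i\<close> can only make the entry at \<open>i\<close> negative.\<close>

lemma sstab_le_c_max:
  assumes "M_matrix M" and f: "f \<in> sstab M"
  shows "f \<le> c_max M"
proof -
  have "f $ i \<le> M $ i $ i - 1" for i
  proof -
    have "0 \<le> (axis i 1 :: int ^ 'a)" "(axis i 1 :: int ^ 'a) \<noteq> 0"
      by (auto simp: less_eq_vec_def axis_def vec_eq_iff)
    then obtain j where j: "f $ j < M $ j $ i"
      using f by (auto simp: sstab_def matrix_vector_mult_axis_nth)
    moreover have "0 \<le> f $ j"
      using f by (simp add: sstab_def less_eq_vec_def)
    ultimately have "j = i"
      using assms(1) unfolding M_matrix_def by (metis not_less order.trans)
    with j show ?thesis by simp
  qed
  then show ?thesis by (simp add: less_eq_vec_def c_max_def)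
qed

text \<open>From left to right, \<open>g\<close> is reached by firing down from an ample configuration \<open>g + M z\<close> with
  \<open>z \<ge> 0\<close>, which exists because \<open>M z\<close> can be made arbitrarily large. The converse is the
  invariant.\<close>

lemma sstab_iff_recurrent:
  assumes M: "M_matrix M"
  shows "c_max M - g \<in> sstab M \<longleftrightarrow> recurrent M g \<and> g \<le> c_max M"
proof
  assume f: "c_max M - g \<in> sstab M"
  obtain z where z: "0 \<le> z" "(\<chi> i. M $ i $ i) - g \<le> M *v z"
    using M_matrix_dominates[OF M] by metis
  have "recurrent M (g + M *v z)"
  proof (rule recurrent.ample)
    show "M $ i $ i \<le> (g + M *v z) $ i" for i
      using z(2) by (simp add: less_eq_vec_def algebra_simps)
  qed
  then have "recurrent M (c_max M - (c_max M - g))"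
    using z(1) by (intro recurrent_fire_down[OF M f]) simp_all
  moreover have "g \<le> c_max M"
    using f by (simp add: sstab_def less_eq_vec_def)
  ultimately show "recurrent M g \<and> g \<le> c_max M" by simp
next
  assume g: "recurrent M g \<and> g \<le> c_max M"
  have "\<exists>i. (c_max M - g) $ i - (M *v z) $ i < 0" if "0 \<le> z" "z \<noteq> 0" for z
  proof (rule ccontr)
    assume "\<nexists>i. (c_max M - g) $ i - (M *v z) $ i < 0"
    then have "g + M *v z \<le> c_max M"
      by (auto simp: less_eq_vec_def not_less algebra_simps)
    then have "z \<le> 0"
      using recurrent_invariant[OF M] g by blast
    with that show False by simp
  qed
  then show "c_max M - g \<in> sstab M"
    using g by (auto simp: sstab_def less_eq_vec_def)
qed

section \<open>Preimages and their integer parts\<close>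

lemma floor_vec_nth [simp]: "floor_vec x $ i = \<lfloor>x $ i\<rfloor>"
  by (simp add: floor_vec_def)

lemma floor_vec_diff: "floor_vec (x - real_vec v) = floor_vec x - v"
  by (simp add: vec_eq_iff)

lemma floor_vec_nonneg_iff: "0 \<le> floor_vec x \<longleftrightarrow> 0 \<le> x"
  by (simp add: less_eq_vec_def)

lemma real_vec_floor_plus_frac: "real_vec (floor_vec x) + frac_vec x = x"
  by (simp add: frac_vec_def)

lemma floor_vec_plus_frac: "floor_vec (real_vec v + frac_vec x) = v"
  by (simp add: vec_eq_iff frac_vec_def)

lemma frac_vec_plus_frac: "frac_vec (real_vec v + frac_vec x) = frac_vec x"
  by (simp add: frac_vec_def[of "real_vec v + frac_vec x"] floor_vec_plus_frac)

lemma integral_real_vec [simp]: "integral_vec (real_vec v)"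
  by (simp add: integral_vec_def)

lemma integral_vec_add: "integral_vec a \<Longrightarrow> integral_vec b \<Longrightarrow> integral_vec (a + b)"
  by (simp add: integral_vec_def)

lemma integral_vec_diff: "integral_vec a \<Longrightarrow> integral_vec b \<Longrightarrow> integral_vec (a - b)"
  by (simp add: integral_vec_def)

lemma integral_vec_minus [simp]: "integral_vec (- a) \<longleftrightarrow> integral_vec a"
  by (simp add: integral_vec_def)

lemma frac_vec_eq_iff: "frac_vec a = frac_vec b \<longleftrightarrow> integral_vec (a - b)"
proof
  assume "frac_vec a = frac_vec b"
  then have "a - b = real_vec (floor_vec a - floor_vec b)"
    by (simp add: frac_vec_def real_vec_diff algebra_simps)
  then show "integral_vec (a - b)" by simp
next
  assume int: "integral_vec (a - b)"
  have "a $ i - \<lfloor>a $ i\<rfloor> = b $ i - \<lfloor>b $ i\<rfloor>" for i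
  proof -
    obtain k where "a $ i - b $ i = of_int k"
      using int by (auto simp: integral_vec_def elim: Ints_cases)
    then have "a $ i = b $ i + of_int k" by simp
    then show ?thesis by simp
  qed
  then show "frac_vec a = frac_vec b"
    by (simp add: frac_vec_def vec_eq_iff)
qed

lemma LMinv_M:
  assumes "M_matrix M"
  shows "LMinv L M *v real_vec (M *v z) = real_vec (L *v z)"
  by (simp add: LMinv_def M_matrix_inv_mult[OF assms] real_vec_mult[of L]
      flip: matrix_vector_mul_assoc)

lemma LMinv_MLinv:
  assumes "chip_firing_pair L M"
  shows "LMinv L M *v (MLinv L M *v c) = c" and "MLinv L M *v (LMinv L M *v x) = x"
proof -
  have inv: "A *v (matrix_inv A *v y) = y" "matrix_inv A *v (A *v y) = y"
    if "invertible A" for A :: "real ^ 'a ^ 'a" and y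
    using that by (simp_all add: matrix_vector_mul_assoc invertible_matrix_inv)
  show "LMinv L M *v (MLinv L M *v c) = c" "MLinv L M *v (LMinv L M *v x) = x"
    using assms
    by (simp_all add: LMinv_def MLinv_def chip_firing_pair_def M_matrix_def inv
        flip: matrix_vector_mul_assoc)
qed

lemma LMinv_fire:
  assumes "M_matrix M"
  shows "LMinv L M *v x - real_mat L *v real_vec z = LMinv L M *v (x - real_vec (M *v z))"
  by (simp add: matrix_vector_mult_diff_distrib LMinv_M[OF assms] real_vec_mult[of L])

lemma S_plus_iff:
  assumes "chip_firing_pair L M"
  shows "LMinv L M *v x \<in> S_plus L M \<longleftrightarrow> x \<in> R_plus L M"
  unfolding S_plus_def using LMinv_MLinv(2)[OF assms] by (auto; metis)

text \<open>Firing moves a preimage by an integer vector, so whether a firing is legal depends only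
  on the integer part of the preimage. This reduces chip-firing on \<open>(L, M)\<close> to chip-firing
  on \<open>M\<close>.\<close>

lemma fire_in_S_plus_iff:
  assumes "chip_firing_pair L M" and "x \<in> R_plus L M"
  shows "LMinv L M *v x - real_mat L *v real_vec z \<in> S_plus L M
    \<longleftrightarrow> 0 \<le> floor_vec x - M *v z"
proof -
  have M: "M_matrix M"
    using assms by (simp add: chip_firing_pair_def)
  have "integral_vec (LMinv L M *v (x - real_vec (M *v z)))"
    using assms by (simp add: R_plus_def matrix_vector_mult_diff_distrib LMinv_M[OF M] integral_vec_diff)
  then have "x - real_vec (M *v z) \<in> R_plus L M \<longleftrightarrow> 0 \<le> floor_vec (x - real_vec (M *v z))"
    by (simp add: R_plus_def floor_vec_nonneg_iff)
  then show ?thesis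
    unfolding LMinv_fire[OF M] S_plus_iff[OF assms(1)] floor_vec_diff .
qed

lemma sstab_pre_iff:
  assumes pair: "chip_firing_pair L M"
  shows "x \<in> sstab_pre L M \<longleftrightarrow> x \<in> R_plus L M \<and> floor_vec x \<in> sstab M"
proof -
  have "x \<in> sstab_pre L M \<longleftrightarrow> superstable L M (LMinv L M *v x)"
    unfolding sstab_pre_def using LMinv_MLinv[OF pair] by (auto; metis)
  also have "\<dots> \<longleftrightarrow> x \<in> R_plus L M \<and>
      (\<forall>z. 0 \<le> z \<and> z \<noteq> 0 \<longrightarrow> \<not> 0 \<le> floor_vec x - M *v z)"
    unfolding superstable_def S_plus_iff[OF pair] using fire_in_S_plus_iff[OF pair] by auto
  also have "\<dots> \<longleftrightarrow> x \<in> R_plus L M \<and> floor_vec x \<in> sstab M"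
  proof -
    have "0 \<le> floor_vec x" if "x \<in> R_plus L M"
      using that by (simp add: R_plus_def floor_vec_nonneg_iff)
    then show ?thesis
      by (auto simp: sstab_def less_eq_vec_def not_le)
  qed
  finally show ?thesis .
qed

lemma fire_seq_Nil: "fire_seq L d [] = d"
  by (simp add: fire_seq_def)

lemma fire_seq_snoc: "fire_seq L d (is @ [i]) = fire_seq L d is - real_mat L *v axis i 1"
  by (simp add: fire_seq_def algebra_simps)

lemma reachable_imp_recurrent:
  assumes pair: "chip_firing_pair L M" and "reachable L M (LMinv L M *v x)"
  shows "recurrent M (floor_vec x)"
proof -
  have M: "M_matrix M"
    using pair by (simp add: chip_firing_pair_def)
  obtain d "is" where d: "d \<in> S_plus L M" "\<And>i. d - real_mat L *v axis i 1 \<in> S_plus L M"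
    and x: "LMinv L M *v x = fire_seq L d is"
    and legal: "\<And>l. l < length is \<Longrightarrow> fire_seq L d (take l is) \<in> S_plus L M"
    using assms(2) unfolding reachable_def by blast
  have legal: "fire_seq L d (take l is) \<in> S_plus L M" if "l \<le> length is" for l
    using that legal[of l] x assms(2) by (cases "l = length is") (auto simp: reachable_def)
  have "recurrent M (floor_vec (MLinv L M *v fire_seq L d (take l is)))" if "l \<le> length is" for l
    using that
  proof (induction l)
    case 0
    obtain y where y: "d = LMinv L M *v y" "y \<in> R_plus L M"
      using d(1) unfolding S_plus_def by blast
    have "M $ i $ i \<le> floor_vec y $ i" for i
      using fire_in_S_plus_iff[OF pair y(2), of "axis i 1"] d(2)[of i] y
        can_fire_iff[OF M, of "floor_vec y" i]
      by (simp add: real_vec_axis R_plus_def floor_vec_nonneg_iff)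
    then show ?case
      by (simp add: fire_seq_Nil y LMinv_MLinv[OF pair] recurrent.ample)
  next
    case (Suc l)
    let ?y = "MLinv L M *v fire_seq L d (take l is)"
    have y: "fire_seq L d (take l is) = LMinv L M *v ?y"
      by (simp add: LMinv_MLinv[OF pair])
    have step: "fire_seq L d (take (Suc l) is)
        = LMinv L M *v ?y - real_mat L *v real_vec (axis (is ! l) 1)"
      using Suc.prems by (simp add: take_Suc_conv_app_nth fire_seq_snoc real_vec_axis flip: y)
    have "?y \<in> R_plus L M"
      using legal[of l] Suc.prems y S_plus_iff[OF pair] by (metis Suc_leD)
    then have "0 \<le> floor_vec ?y - M *v axis (is ! l) 1"
      using fire_in_S_plus_iff[OF pair] legal[OF Suc.prems] unfolding step by blast
    with Suc have "recurrent M (floor_vec ?y - M *v axis (is ! l) 1)"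
      by (intro recurrent.fire) simp_all
    moreover have "MLinv L M *v fire_seq L d (take (Suc l) is)
        = ?y - real_vec (M *v axis (is ! l) 1)"
      unfolding step LMinv_fire[OF M] by (rule LMinv_MLinv(2)[OF pair])
    ultimately show ?case
      by (simp add: floor_vec_diff)
  qed
  from this[of "length is"] show ?thesis
    by (simp add: LMinv_MLinv[OF pair] flip: x)
qed

text \<open>The rule induction runs along the firings of \<open>M\<close>; each one is lifted to \<open>(L, M)\<close> by carrying
  the fractional part of \<open>x\<close> back to the preceding configuration.\<close>

lemma recurrent_imp_reachable:
  assumes pair: "chip_firing_pair L M" and "recurrent M h"
    and "x \<in> R_plus L M" and "floor_vec x = h"
  shows "reachable L M (LMinv L M *v x)"
  using assms(2-4)
proof (induction arbitrary: x rule: recurrent.induct)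
  case (ample d)
  have M: "M_matrix M"
    using pair by (simp add: chip_firing_pair_def)
  have "LMinv L M *v x - real_mat L *v axis i 1 \<in> S_plus L M" for i
    using ample fire_in_S_plus_iff[OF pair ample(2), of "axis i 1"] can_fire_iff[OF M, of d i]
    by (auto simp: real_vec_axis R_plus_def simp flip: floor_vec_nonneg_iff)
  moreover have "LMinv L M *v x \<in> S_plus L M"
    using ample(2) S_plus_iff[OF pair] by blast
  ultimately show ?case
    unfolding reachable_def by (metis fire_seq_Nil less_nat_zero_code list.size(3))
next
  case (fire h i)
  have M: "M_matrix M"
    using pair by (simp add: chip_firing_pair_def)
  define y where "y = x + real_vec (M *v axis i 1)"
  have x: "x = y - real_vec (M *v axis i 1)"
    by (simp add: y_def)
  have h: "floor_vec y = h"
    using fire.prems(2) by (simp add: x floor_vec_diff)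
  have "0 \<le> y"
    using recurrent_nonneg[OF M fire.hyps(1)] h floor_vec_nonneg_iff by metis
  moreover have "integral_vec (LMinv L M *v y)"
    using fire.prems(1)
    by (simp add: y_def R_plus_def matrix_vector_right_distrib LMinv_M[OF M] integral_vec_add)
  ultimately have y: "y \<in> R_plus L M"
    by (simp add: R_plus_def)
  from fire.IH[OF y h] obtain d "is" where
    d: "d \<in> S_plus L M" "\<forall>i. d - real_mat L *v axis i 1 \<in> S_plus L M"
    and seq: "LMinv L M *v y = fire_seq L d is"
    and legal: "\<And>l. l < length is \<Longrightarrow> fire_seq L d (take l is) \<in> S_plus L M"
    unfolding reachable_def by blast
  have "LMinv L M *v x = fire_seq L d (is @ [i])"
    unfolding fire_seq_snoc seq[symmetric] x
    by (simp add: real_vec_axis flip: LMinv_fire[OF M])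
  moreover have "fire_seq L d (take l (is @ [i])) \<in> S_plus L M" if "l < length (is @ [i])" for l
  proof (cases "l < length is")
    case True
    then show ?thesis using legal by simp
  next
    case False
    then have "l = length is" using that by simp
    then show ?thesis
      using y S_plus_iff[OF pair] by (simp flip: seq)
  qed
  moreover have "LMinv L M *v x \<in> S_plus L M"
    using fire.prems(1) S_plus_iff[OF pair] by blast
  ultimately show ?case
    unfolding reachable_def using d by blast
qed

lemma stable_iff:
  assumes pair: "chip_firing_pair L M"
  shows "stable L M (LMinv L M *v x) \<longleftrightarrow> x \<in> R_plus L M \<and> floor_vec x \<le> c_max M"
proof -
  have M: "M_matrix M"
    using pair by (simp add: chip_firing_pair_def)
  have "LMinv L M *v x - real_mat L *v axis i 1 \<in> S_plus L M \<longleftrightarrow> M $ i $ i \<le> floor_vec x $ i"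
    if "x \<in> R_plus L M" for i
    using fire_in_S_plus_iff[OF pair that, of "axis i 1"] can_fire_iff[OF M, of "floor_vec x" i] that
    by (simp add: real_vec_axis R_plus_def floor_vec_nonneg_iff)
  then show ?thesis
    unfolding stable_def S_plus_iff[OF pair]
    by (cases "x \<in> R_plus L M") (simp_all add: less_eq_vec_def c_max_def not_le del: floor_vec_nth)
qed

lemma crit_pre_iff:
  assumes pair: "chip_firing_pair L M"
  shows "x \<in> crit_pre L M \<longleftrightarrow> x \<in> R_plus L M \<and> c_max M - floor_vec x \<in> sstab M"
proof -
  have M: "M_matrix M"
    using pair by (simp add: chip_firing_pair_def)
  have "x \<in> crit_pre L M \<longleftrightarrow> critical L M (LMinv L M *v x)"
    unfolding crit_pre_def using LMinv_MLinv[OF pair] by (auto; metis)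
  also have "\<dots> \<longleftrightarrow> x \<in> R_plus L M \<and> floor_vec x \<le> c_max M \<and> recurrent M (floor_vec x)"
    unfolding critical_def stable_iff[OF pair]
    using reachable_imp_recurrent[OF pair] recurrent_imp_reachable[OF pair] by blast
  finally show ?thesis
    using sstab_iff_recurrent[OF M] by blast
qed

section \<open>The involution and the bijection\<close>

lemma mu_alt:
  "mu L M s = (if integral_vec (LMinv L M *v real_vec (s + s - c_max M)) then s
    else sstab_rep M (c_max M - s))"
proof -
  have "2 *\<^sub>R real_vec s = real_vec (s + s)"
    by (simp add: vec_eq_iff)
  then show ?thesis
    by (simp add: mu_def frac_vec_eq_iff real_vec_diff matrix_vector_mult_diff_distrib)
qed

lemma mu_in_sstab:
  assumes "M_matrix M" and "s \<in> sstab M"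
  shows "mu L M s \<in> sstab M"
  using assms by (simp add: mu_alt sstab_rep_properties)

text \<open>The reason for the case distinction in \<open>mu\<close>, and the fact that keeps \<open>chi_map\<close> and its
  inverse inside \<open>R_plus\<close>. The sum \<open>mu s + s\<close> is \<open>2s\<close> in the first case of the definition,
  which applies exactly when \<open>2s\<close> is congruent to \<open>c_max\<close> modulo vectors with integral image
  under \<open>LMinv\<close>; it is congruent to \<open>c_max\<close> modulo the image of \<open>M\<close> in the second.\<close>

lemma mu_add_self:
  assumes "M_matrix M"
  shows "integral_vec (LMinv L M *v real_vec (mu L M s + s - c_max M))"
proof (cases "integral_vec (LMinv L M *v real_vec (s + s - c_max M))")
  case True
  then show ?thesis by (simp add: mu_alt)
next
  case False
  obtain z where "sstab_rep M (c_max M - s) = c_max M - s + M *v z"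
    using sstab_rep_properties(2)[OF assms] by blast
  then have "mu L M s + s - c_max M = M *v z"
    using False by (simp add: mu_alt)
  then show ?thesis
    by (simp add: LMinv_M[OF assms])
qed

text \<open>In the second case of the definition \<open>t = mu s\<close> is congruent to \<open>c_max - s\<close> modulo the
  image of \<open>M\<close>, so \<open>2t - c_max\<close> is congruent to \<open>-(2s - c_max)\<close>: the element \<open>t\<close> is again in
  the second case, and \<open>s\<close> is the superstable representative of \<open>c_max - t\<close>.\<close>

lemma mu_involution:
  assumes M: "M_matrix M" and s: "s \<in> sstab M"
  shows "mu L M (mu L M s) = s"
proof (cases "integral_vec (LMinv L M *v real_vec (s + s - c_max M))")
  case True
  then show ?thesis by (simp add: mu_alt)
next
  case False
  define t where "t = sstab_rep M (c_max M - s)"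
  obtain z where t: "t = c_max M - s + M *v z"
    using sstab_rep_properties(2)[OF M] t_def by blast
  have "s + s - c_max M = M *v (z + z) - (t + t - c_max M)"
    unfolding t by (simp only: matrix_vector_right_distrib) (simp add: vec_eq_iff)
  then have "LMinv L M *v real_vec (s + s - c_max M)
      = LMinv L M *v real_vec (M *v (z + z)) - LMinv L M *v real_vec (t + t - c_max M)"
    by (simp only: real_vec_diff matrix_vector_mult_diff_distrib)
  then have "\<not> integral_vec (LMinv L M *v real_vec (t + t - c_max M))"
    using False integral_vec_diff by (metis LMinv_M[OF M] integral_real_vec)
  moreover have "sstab_rep M (c_max M - t) = s"
    using t by (intro sstab_rep_eqI[OF M s, of _ z]) simp
  ultimately show ?thesis
    using False by (simp add: mu_alt flip: t_def)
qed

lemma replace_floor_in_R_plus: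
  assumes "x \<in> R_plus L M" and "0 \<le> v"
    and "integral_vec (LMinv L M *v real_vec (v - floor_vec x))"
  shows "real_vec v + frac_vec x \<in> R_plus L M"
proof -
  have "real_vec v + frac_vec x = x + real_vec (v - floor_vec x)"
    by (simp add: frac_vec_def real_vec_diff)
  then have "integral_vec (LMinv L M *v (real_vec v + frac_vec x))"
    using assms by (simp add: matrix_vector_right_distrib R_plus_def integral_vec_add)
  moreover have "0 \<le> real_vec v + frac_vec x"
    using assms(2) by (subst floor_vec_nonneg_iff[symmetric]) (simp add: floor_vec_plus_frac)
  ultimately show ?thesis
    by (simp add: R_plus_def)
qed

theorem theorem3p6:
  fixes L M :: "int ^ 'n ^ 'n"
  assumes "chip_firing_pair L M"
  shows "chi_map L M \<in> sstab_pre L M \<rightarrow> crit_pre L M \<and>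
         bij_betw (chi_map L M) (sstab_pre L M) (crit_pre L M)"
proof -
  have M: "M_matrix M"
    using assms by (simp add: chip_firing_pair_def)
  define \<psi> where "\<psi> y = real_vec (mu L M (c_max M - floor_vec y)) + frac_vec y" for y
  have chi: "chi_map L M x = real_vec (c_max M - mu L M (floor_vec x)) + frac_vec x" for x
    by (simp add: chi_map_def real_vec_diff)
  have chi_in: "chi_map L M x \<in> crit_pre L M" if "x \<in> sstab_pre L M" for x
  proof -
    let ?m = "mu L M (floor_vec x)"
    have x: "x \<in> R_plus L M" "floor_vec x \<in> sstab M"
      using that sstab_pre_iff[OF assms] by auto
    have m: "?m \<in> sstab M"
      using mu_in_sstab[OF M x(2)] .
    have "LMinv L M *v real_vec (c_max M - ?m - floor_vec x)
        = - (LMinv L M *v real_vec (?m + floor_vec x - c_max M))"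
      by (simp add: algebra_simps real_vec_diff real_vec_add)
    then have "integral_vec (LMinv L M *v real_vec (c_max M - ?m - floor_vec x))"
      using mu_add_self[OF M] by simp
    moreover have "0 \<le> c_max M - ?m"
      using sstab_le_c_max[OF M m] by (simp add: less_eq_vec_def)
    ultimately have "chi_map L M x \<in> R_plus L M"
      unfolding chi by (intro replace_floor_in_R_plus[OF x(1)])
    then show ?thesis
      using m by (simp add: crit_pre_iff[OF assms]) (simp add: chi floor_vec_plus_frac)
  qed
  have psi_in: "\<psi> y \<in> sstab_pre L M" if "y \<in> crit_pre L M" for y
  proof -
    let ?g = "c_max M - floor_vec y"
    have y: "y \<in> R_plus L M" "?g \<in> sstab M"
      using that crit_pre_iff[OF assms] by auto
    have m: "mu L M ?g \<in> sstab M"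
      using mu_in_sstab[OF M y(2)] .
    moreover have "integral_vec (LMinv L M *v real_vec (mu L M ?g - floor_vec y))"
      using mu_add_self[OF M, of L ?g] by simp
    ultimately have "\<psi> y \<in> R_plus L M"
      unfolding \<psi>_def by (intro replace_floor_in_R_plus[OF y(1)]) (simp_all add: sstab_def)
    then show ?thesis
      using m by (simp add: sstab_pre_iff[OF assms]) (simp add: \<psi>_def floor_vec_plus_frac)
  qed
  have "bij_betw (chi_map L M) (sstab_pre L M) (crit_pre L M)"
  proof (rule bij_betwI[where g = \<psi>])
    show "\<psi> (chi_map L M x) = x" if "x \<in> sstab_pre L M" for x
      using that mu_involution[OF M]
      by (simp add: sstab_pre_iff[OF assms] \<psi>_def chi floor_vec_plus_frac frac_vec_plus_frac
          real_vec_floor_plus_frac)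
    show "chi_map L M (\<psi> y) = y" if "y \<in> crit_pre L M" for y
      using that mu_involution[OF M]
      by (simp add: crit_pre_iff[OF assms] \<psi>_def chi floor_vec_plus_frac frac_vec_plus_frac
          real_vec_floor_plus_frac)
  qed (use chi_in psi_in in blast)+
  with chi_in show ?thesis by blast
qed

end
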